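(* Let $A$ be an $m\times n$ Archdeacon array on an abelian group $G$ with simple orderings $\omega_r=\omega_{\overline R_1}\circ\dots\circ\omega_{\overline R_m}$ for the rows and $\omega_c=\omega_{\overline C_1}\circ\dots\circ\omega_{\overline C_n}$ for the columns. Then: (1) $\mathcal{B}_{\omega_r}=\{\mathcal{S}(\omega_{\overline R_i})\mid 1\le i\le m\}$ is a set of base cycles of a $G$-regular cycle decomposition $\mathcal{D}_{\omega_r}$ of $\mathrm{Cay}[G:\pm\mathcal{E}(A)]$; (2) $\mathcal{B}_{\omega_c}=\{\mathcal{S}(\omega_{\overline C_j})\mid 1\le j\le n\}$ is a set of base cycles of a $G$-regular cycle decomposition $\mathcal{D}_{\omega_c}$ of $\mathrm{Cay}[G:\pm\mathcal{E}(A)]$; (3) the cycle decompositions $\mathcal{D}_{\omega_r}$ and $\mathcal{D}_{\omega_c}$ are orthogonal. (Empty rows and columns contribute no base cycle.)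
   Context: A partially filled (p.f.) array is a matrix in which some cells may be empty; $\mathcal{E}(A)$ is the list of the elements in the filled cells of $A$, and $\overline R_i,\overline C_j$ are its $i$-th row and $j$-th column. An Archdeacon array over an abelian group $(G,+)$ is an $m\times n$ p.f. array $A$ with elements in $G$ such that: (a) $\mathcal{E}(A)$ is a set (no repeated entries); (b) for every $g\in G$, $g\in\mathcal{E}(A)$ implies $-g\notin\mathcal{E}(A)$; (c) the elements in every row and column sum to $0$. An ordering $\omega=(t_1,\dots,t_\ell)$ of elements of $G$ has partial sums $s_i=t_1+\dots+t_i$, and $\mathcal{S}(\omega)=(s_1,\dots,s_\ell)$; $\omega$ is simple if $s_1,\dots,s_\ell$ are pairwise distinct. Here $\omega_{\overline R_i}$ and $\omega_{\overline C_j}$ are simple orderings of the entries of $\overline R_i$ and of $\overline C_j$, respectively. $\mathcal{S}(\omega)$ is regarded as the cycle with consecutive vertices $s_1,\dots,s_\ell$ (and $s_\ell$ adjacent to $s_1$). For $\Lambda\subseteq G\setminus\{0\}$ with $\Lambda=-\Lambda$, $\mathrm{Cay}[G:\Lambda]$ is the simple graph with vertex set $G$ in which $x,y$ are adjacent iff $x-y\in\Lambda$. A cycle decomposition of a graph $K$ is a set of cycles in $K$ whose edge sets partition $E(K)$ (cycles may have different lengths). For a graph with vertices in $G$, a cycle decomposition is $G$-regular if it is invariant under $G$ acting by translations on the vertex set $G$; a set $\mathcal{B}$ of cycles is a set of base cycles of it if the decomposition is $\{B+g\mid B\in\mathcal{B},\,g\in G\}$. Two decompositions $\mathcal{D},\mathcal{D}'$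 are orthogonal if every $B\in\mathcal{D}$ and every $B'\in\mathcal{D}'$ share at most one edge. *)

theory Defs
  imports Main "HOL-Library.Multiset" "HOL-Library.Disjoint_Sets"
begin

section \<open>Partially filled arrays\<close>

text \<open>An \<open>m \<times> n\<close> partially filled array is a function \<open>A\<close> restricted to the cells \<open>(i, j)\<close> with
  \<open>1 \<le> i \<le> m\<close> and \<open>1 \<le> j \<le> n\<close>; the value \<^const>\<open>None\<close> marks an empty cell, and the values
  of \<open>A\<close> outside this range are never used.\<close>

definition row_entries :: "nat \<Rightarrow> (nat \<Rightarrow> nat \<Rightarrow> 'g option) \<Rightarrow> nat \<Rightarrow> 'g list" where
  "row_entries n A i = List.map_filter (\<lambda>j. A i j) [1..<Suc n]"

definition col_entries :: "nat \<Rightarrow> (nat \<Rightarrow> nat \<Rightarrow> 'g option) \<Rightarrow> nat \<Rightarrow> 'g list" where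
  "col_entries m A j = List.map_filter (\<lambda>i. A i j) [1..<Suc m]"

definition entries :: "nat \<Rightarrow> nat \<Rightarrow> (nat \<Rightarrow> nat \<Rightarrow> 'g option) \<Rightarrow> 'g list" where
  "entries m n A = concat (map (row_entries n A) [1..<Suc m])"

definition archdeacon_array ::
    "nat \<Rightarrow> nat \<Rightarrow> (nat \<Rightarrow> nat \<Rightarrow> 'g::ab_group_add option) \<Rightarrow> bool" where
  "archdeacon_array m n A \<longleftrightarrow>
     distinct (entries m n A) \<and>
     (\<forall>g. g \<in> set (entries m n A) \<longrightarrow> - g \<notin> set (entries m n A)) \<and>
     (\<forall>i\<in>{1..m}. sum_list (row_entries n A i) = 0) \<and>
     (\<forall>j\<in>{1..n}. sum_list (col_entries m A j) = 0)"


section \<open>Simple orderings\<close>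

definition partial_sums :: "'g::ab_group_add list \<Rightarrow> 'g list" where
  "partial_sums \<omega> = map (\<lambda>k. sum_list (take k \<omega>)) [1..<Suc (length \<omega>)]"

definition ordering_of :: "'g list \<Rightarrow> 'g list \<Rightarrow> bool" where
  "ordering_of \<omega> xs \<longleftrightarrow> mset \<omega> = mset xs"

definition simple_ordering :: "'g::ab_group_add list \<Rightarrow> bool" where
  "simple_ordering \<omega> \<longleftrightarrow> distinct (partial_sums \<omega>)"


section \<open>Graphs and cycle decompositions\<close>

text \<open>A simple graph is a pair of a vertex set and a set of edges, an edge being the
  two-element set of its end points.  Cycles are subgraphs, so that the starting point and the
  direction of a traversal are immaterial.\<close>

type_synonym 'a graph = "'a set \<times> 'a set set"

abbreviation verts :: "'a graph \<Rightarrow> 'a set" where "verts \<equiv> fst"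
abbreviation edges :: "'a graph \<Rightarrow> 'a set set" where "edges \<equiv> snd"

definition subgraph :: "'a graph \<Rightarrow> 'a graph \<Rightarrow> bool" where
  "subgraph H K \<longleftrightarrow> verts H \<subseteq> verts K \<and> edges H \<subseteq> edges K"

definition cycle_of :: "'a list \<Rightarrow> 'a graph" where
  "cycle_of xs = (set xs, {{xs ! k, xs ! (Suc k mod length xs)} | k. k < length xs})"

definition is_cycle :: "'a graph \<Rightarrow> bool" where
  "is_cycle C \<longleftrightarrow> (\<exists>xs. 3 \<le> length xs \<and> distinct xs \<and> C = cycle_of xs)"

definition cycle_decomposition :: "'a graph \<Rightarrow> 'a graph set \<Rightarrow> bool" where
  "cycle_decomposition K D \<longleftrightarrow>
     (\<forall>C\<in>D. is_cycle C \<and> subgraph C K) \<and>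
     disjoint_family_on edges D \<and> (\<Union>C\<in>D. edges C) = edges K"

definition orthogonal_decompositions :: "'a graph set \<Rightarrow> 'a graph set \<Rightarrow> bool" where
  "orthogonal_decompositions D D' \<longleftrightarrow>
     (\<forall>B\<in>D. \<forall>B'\<in>D'. \<forall>e\<in>edges B \<inter> edges B'. \<forall>f\<in>edges B \<inter> edges B'. e = f)"


section \<open>Cayley graphs and regular decompositions\<close>

definition pm :: "'g::ab_group_add set \<Rightarrow> 'g set" where
  "pm X = X \<union> uminus ` X"

text \<open>The connection set \<open>\<Lambda>\<close> is meant to be closed under negation and not to contain \<open>0\<close>; see
  \<open>archdeacon_array_connection_set\<close> below.\<close>

definition Cay :: "'g::ab_group_add set \<Rightarrow> 'g graph" where
  "Cay \<Lambda> = (UNIV, {{x, y} | x y. x - y \<in> \<Lambda>})"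

definition translate :: "'g::ab_group_add \<Rightarrow> 'g graph \<Rightarrow> 'g graph" where
  "translate g H = ((\<lambda>x. x + g) ` verts H, (\<lambda>e. (\<lambda>x. x + g) ` e) ` edges H)"

definition regular_cycle_decomposition :: "'g::ab_group_add graph \<Rightarrow> 'g graph set \<Rightarrow> bool" where
  "regular_cycle_decomposition K D \<longleftrightarrow>
     cycle_decomposition K D \<and> (\<forall>g. translate g ` D = D)"

definition base_cycles :: "'g::ab_group_add graph set \<Rightarrow> 'g graph set \<Rightarrow> bool" where
  "base_cycles \<B> D \<longleftrightarrow> (\<forall>B\<in>\<B>. is_cycle B) \<and> D = {translate g B | B g. B \<in> \<B>}"

text \<open>The cycles of partial sums of the orderings \<open>\<omega> 1, \<dots>, \<omega> k\<close> of the rows (or columns);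
  an empty row or column contributes none.\<close>

definition partial_sum_cycles :: "nat \<Rightarrow> (nat \<Rightarrow> 'g::ab_group_add list) \<Rightarrow> 'g graph set" where
  "partial_sum_cycles k \<omega> = {cycle_of (partial_sums (\<omega> i)) | i. i \<in> {1..k} \<and> \<omega> i \<noteq> []}"

lemma archdeacon_array_connection_set:
  assumes "archdeacon_array m n A"
  shows "0 \<notin> pm (set (entries m n A))"
    and "uminus ` pm (set (entries m n A)) = pm (set (entries m n A))"
  using assms by (force simp: archdeacon_array_def pm_def image_Un image_image)+

end

theory Submission imports Defs begin

text \<open>Since no entry is the negative of another (or of itself), every edge of the Cayley graph has a
  unique form \<open>{x, x + a}\<close> with \<open>a\<close> an entry.  The cycle of partial sums of a zero-sum ordering has,
  for each of its entries \<open>a\<close>, exactly one edge of difference \<open>a\<close>, so the translates of that cycle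
  contain every edge of difference \<open>a\<close> exactly once; rows (and columns) partition the entries.  A row
  cycle and a column cycle can only share an edge whose difference is the entry in the common cell.\<close>

section \<open>Entries of partially filled arrays\<close>

lemma set_map_filter_eq: "set (List.map_filter f xs) = {y. \<exists>x\<in>set xs. f x = Some y}"
  by (force simp: List.map_filter_def)

lemma distinct_map_filter_iff:
  assumes "distinct xs"
  shows "distinct (List.map_filter f xs) \<longleftrightarrow>
    (\<forall>x\<in>set xs. \<forall>y\<in>set xs. \<forall>a. f x = Some a \<longrightarrow> f y = Some a \<longrightarrow> x = y)"
  using assms
proof (induction xs)
  case Nil
  then show ?case by (simp add: List.map_filter_def)
next
  case (Cons x xs)
  then show ?case
    by (cases "f x") (auto simp: set_map_filter_eq)
qed

lemma distinct_concat_map_iff: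
  assumes "distinct xs"
  shows "distinct (concat (map f xs)) \<longleftrightarrow>
    (\<forall>x\<in>set xs. distinct (f x)) \<and> disjoint_family_on (\<lambda>x. set (f x)) (set xs)"
  using assms
  by (induction xs) (auto simp: disjoint_family_on_insert disjoint_family_on_def[of _ "{}"])

lemma set_row_entries: "set (row_entries n A i) = {a. \<exists>j\<in>{1..n}. A i j = Some a}"
  by (auto simp: row_entries_def set_map_filter_eq)

lemma set_col_entries: "set (col_entries m A j) = {a. \<exists>i\<in>{1..m}. A i j = Some a}"
  by (auto simp: col_entries_def set_map_filter_eq)

lemma set_entries_rows: "set (entries m n A) = (\<Union>i\<in>{1..m}. set (row_entries n A i))"
  by (simp add: entries_def atLeastLessThanSuc_atLeastAtMost del: upt_Suc)

lemma set_entries_cols: "set (entries m n A) = (\<Union>j\<in>{1..n}. set (col_entries m A j))"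
  by (auto simp: set_entries_rows set_row_entries set_col_entries)

text \<open>Distinctness of the row-by-row concatenation makes the rows pairwise disjoint, which
  gives \<open>i = i'\<close>, and each row repetition-free, which gives \<open>j = j'\<close>. In
  this cell form the condition no longer favours rows over columns, so facts about columns follow
  from it as well.\<close>

lemma distinct_entries_cell_unique:
  assumes "distinct (entries m n A)"
    and "i \<in> {1..m}" "j \<in> {1..n}" "A i j = Some a"
    and "i' \<in> {1..m}" "j' \<in> {1..n}" "A i' j' = Some a"
  shows "i = i' \<and> j = j'"
proof -
  have rows: "\<forall>i\<in>{1..m}. distinct (row_entries n A i)"
    and disj: "disjoint_family_on (\<lambda>i. set (row_entries n A i)) {1..m}"
    using assms(1)
    by (simp_all add: entries_def distinct_concat_map_iff atLeastLessThanSuc_atLeastAtMost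
        del: upt_Suc)
  have "a \<in> set (row_entries n A i)" "a \<in> set (row_entries n A i')"
    using assms by (auto simp: set_row_entries)
  then have "i = i'"
    using disj assms(2,5) unfolding disjoint_family_on_def by blast
  moreover have "distinct (List.map_filter (\<lambda>j. A i j) [1..<Suc n])"
    using rows assms(2) unfolding row_entries_def by blast
  then have "\<forall>j\<in>{1..n}. \<forall>j'\<in>{1..n}. \<forall>a. A i j = Some a \<longrightarrow> A i j' = Some a \<longrightarrow> j = j'"
    unfolding distinct_map_filter_iff[OF distinct_upt] set_upt atLeastLessThanSuc_atLeastAtMost .
  ultimately show ?thesis
    using assms by blast
qed

lemma distinct_col_entries:
  assumes "distinct (entries m n A)" "j \<in> {1..n}"
  shows "distinct (col_entries m A j)"
  unfolding col_entries_def
  unfolding distinct_map_filter_iff[OF distinct_upt] set_upt atLeastLessThanSuc_atLeastAtMost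
  using distinct_entries_cell_unique[OF assms(1)] assms(2) by blast

lemma distinct_row_entries:
  assumes "distinct (entries m n A)" "i \<in> {1..m}"
  shows "distinct (row_entries n A i)"
  unfolding row_entries_def
  unfolding distinct_map_filter_iff[OF distinct_upt] set_upt atLeastLessThanSuc_atLeastAtMost
  using distinct_entries_cell_unique[OF assms(1)] assms(2) by blast

section \<open>Edges of cycles of partial sums\<close>

lemma length_partial_sums [simp]: "length (partial_sums w) = length w"
  by (simp add: partial_sums_def del: upt_Suc)

lemma nth_partial_sums: "k < length w \<Longrightarrow> partial_sums w ! k = sum_list (take (Suc k) w)"
  by (simp add: partial_sums_def del: upt_Suc)

lemma sum_list_take_Suc:
  fixes w :: "'g::comm_monoid_add list"
  shows "k < length w \<Longrightarrow> sum_list (take (Suc k) w) = sum_list (take k w) + w ! k"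
  by (simp add: take_Suc_conv_app_nth)

text \<open>\<open>partial_sums\<close> leaves out the empty prefix, but as the total is 0 the last
  partial sum takes its place. Hence every edge can be indexed by a proper prefix, its tail, and the
  step from there is exactly one entry \<open>w ! k\<close>.\<close>

lemma edges_partial_sum_cycle:
  assumes "sum_list w = 0"
  shows "edges (cycle_of (partial_sums w)) =
    {{sum_list (take k w), sum_list (take k w) + w ! k} | k. k < length w}"
proof -
  define l where "l = length w"
  have edge: "{partial_sums w ! k, partial_sums w ! (Suc k mod l)} =
      {sum_list (take (Suc k mod l) w), sum_list (take (Suc k mod l) w) + w ! (Suc k mod l)}"
    if "k < l" for k
  proof (cases "Suc k = l")
    \<comment> \<open>The closing edge runs from the last partial sum, 0, to the first one,
      \<open>w ! 0\<close>; it is the edge at the empty prefix.\<close>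
    case True
    then have "Suc k mod l = 0" by simp
    moreover have "0 < length w" using that unfolding l_def by linarith
    then have "partial_sums w ! 0 = w ! 0"
      by (simp only: nth_partial_sums sum_list_take_Suc) simp
    moreover have "partial_sums w ! k = 0"
      using assms that True by (simp add: nth_partial_sums l_def)
    ultimately show ?thesis by simp
  next
    case False
    then have "Suc k < l" using that by simp
    then show ?thesis
      by (simp add: nth_partial_sums sum_list_take_Suc[symmetric] l_def)
  qed
  \<comment> \<open>The cyclic successor reaches every index, 0 being the successor of
    \<open>l - 1\<close>; so reindexing by it loses no edge.\<close>
  have surj: "\<exists>k'<l. k = Suc k' mod l" if "k < l" for k
  proof (cases k)
    case 0
    then show ?thesis using that by (intro exI[of _ "l - 1"]) simp
  next
    case (Suc k')
    then show ?thesis using that by (intro exI[of _ k']) simp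
  qed
  have "edges (cycle_of (partial_sums w)) =
      {{partial_sums w ! k, partial_sums w ! (Suc k mod l)} | k. k < l}"
    by (simp add: cycle_of_def l_def)
  also have "\<dots> = {{sum_list (take k w), sum_list (take k w) + w ! k} | k. k < l}"
    (is "?L = ?R")
  proof
    show "?L \<subseteq> ?R"
    proof
      fix e assume "e \<in> ?L"
      then obtain k where k: "k < l" "e = {partial_sums w ! k, partial_sums w ! (Suc k mod l)}"
        by blast
      moreover have "Suc k mod l < l" using k by simp
      ultimately show "e \<in> ?R" using edge[OF k(1)] by blast
    qed
    show "?R \<subseteq> ?L"
    proof
      fix e assume "e \<in> ?R"
      then obtain k where k: "k < l" "e = {sum_list (take k w), sum_list (take k w) + w ! k}"
        by blast
      obtain k' where "k' < l" "k = Suc k' mod l" using surj[OF k(1)] by blast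
      then show "e \<in> ?L" using edge[of k'] k(2) by blast
    qed
  qed
  finally show ?thesis by (simp add: l_def)
qed

text \<open>Translation moves the tail by \<open>g\<close> and leaves the difference
  \<open>w ! k\<close> unchanged; the form tail, tail plus difference is the one that
  \<open>edge_difference_unique\<close> compares.\<close>

lemma edges_translate_partial_sum_cycle:
  assumes "sum_list w = 0"
  shows "edges (translate g (cycle_of (partial_sums w))) =
    {{sum_list (take k w) + g, sum_list (take k w) + g + w ! k} | k. k < length w}"
proof -
  have "(\<lambda>x. x + g) ` {s, s + a} = {s + g, s + g + a}" for s a
    by (simp add: algebra_simps)
  then show ?thesis
    by (simp add: translate_def edges_partial_sum_cycle[OF assms] setcompr_eq_image image_image
        del: image_insert)
qed

section \<open>Translates of cycles\<close>

lemma translate_cycle_of: "translate g (cycle_of xs) = cycle_of (map (\<lambda>x. x + g) xs)"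
proof -
  have "Suc k mod length xs < length xs" if "k < length xs" for k
    using that by (cases xs) simp_all
  then show ?thesis
    by (auto simp: translate_def cycle_of_def setcompr_eq_image image_image intro!: image_cong)
qed

lemma is_cycle_translate:
  assumes "is_cycle C"
  shows "is_cycle (translate g C)"
proof -
  obtain xs where "3 \<le> length xs" "distinct xs" "C = cycle_of xs"
    using assms by (auto simp: is_cycle_def)
  then show ?thesis
    unfolding is_cycle_def translate_cycle_of
    by (intro exI[of _ "map (\<lambda>x. x + g) xs"]) (simp add: distinct_map translate_cycle_of)
qed

lemma translate_translate: "translate g (translate h B) = translate (h + g) B"
  by (simp add: translate_def image_image add.assoc)

text \<open>The family is a union of orbits of the translation action, hence invariant; the preimage
  of the shift \<open>h\<close> under translation by \<open>g\<close> is the shift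
  \<open>h - g\<close>.\<close>

lemma translate_image_translates:
  "translate g ` {translate h B | B h. B \<in> \<B>} = {translate h B | B h. B \<in> \<B>}" (is "_ ` ?D = ?D")
proof
  show "translate g ` ?D \<subseteq> ?D"
    by (clarsimp simp: translate_translate simp del: split_paired_Ex) blast
  show "?D \<subseteq> translate g ` ?D"
  proof
    fix C assume "C \<in> ?D"
    then obtain B h where "B \<in> \<B>" "C = translate h B" by blast
    then have "C = translate g (translate (h - g) B)" by (simp add: translate_translate)
    then show "C \<in> translate g ` ?D" using \<open>B \<in> \<B>\<close> by blast
  qed
qed

section \<open>Edges of the Cayley graph and their differences\<close>

text \<open>The only other way to match the end points is crosswise, and that forces
  \<open>a + b = 0\<close>, so \<open>a = - b\<close>, which is excluded in \<open>E\<close>. In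
  effect \<open>E\<close> orients each edge.\<close>

lemma edge_difference_unique:
  fixes x y :: "'g::ab_group_add"
  assumes "\<forall>g\<in>E. - g \<notin> E" "a \<in> E" "b \<in> E" "{x, x + a} = {y, y + b}"
  shows "x = y \<and> a = b"
proof -
  have "\<not> (x = y + b \<and> x + a = y)"
  proof
    assume "x = y + b \<and> x + a = y"
    then have "y + b + a = y" by metis
    then have "y + (a + b) = y + 0" by (simp add: ac_simps)
    then have "a = - b" by (simp only: add_left_cancel eq_neg_iff_add_eq_0)
    then show False using assms by blast
  qed
  then show ?thesis using assms(4) by (auto simp: doubleton_eq_iff)
qed

text \<open>A difference in the negated half of \<open>pm E\<close> becomes one in \<open>E\<close>
  when the end points are swapped, so the elements of \<open>E\<close> alone describe all
  edges.\<close>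

lemma edges_Cay_pm:
  "edges (Cay (pm E)) = {{x, x + a} | x a. a \<in> E}" (is "?L = ?R")
proof
  show "?L \<subseteq> ?R"
  proof
    fix e assume "e \<in> ?L"
    then obtain x y where e: "e = {x, y}" and "x - y \<in> E \<or> (\<exists>b\<in>E. x - y = - b)"
      unfolding Cay_def pm_def snd_conv by blast
    moreover have "y - x = b" if "x - y = - b" for b
      using that by (metis minus_diff_eq minus_minus)
    ultimately have "x - y \<in> E \<or> y - x \<in> E" by blast
    then show "e \<in> ?R"
    proof (elim disjE)
      assume "x - y \<in> E"
      moreover have "e = {y, y + (x - y)}" using e by (auto simp: insert_commute)
      ultimately show ?thesis by blast
    next
      assume "y - x \<in> E"
      moreover have "e = {x, x + (y - x)}" using e by simp
      ultimately show ?thesis by blast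
    qed
  qed
  show "?R \<subseteq> ?L"
  proof
    fix e assume "e \<in> ?R"
    then obtain x a where e: "e = {x + a, x}" "a \<in> E" by (auto simp: insert_commute)
    moreover have "x + a - x \<in> pm E" using e by (simp add: pm_def)
    ultimately show "e \<in> ?L" unfolding Cay_def snd_conv by blast
  qed
qed

section \<open>Decompositions from families of zero-sum orderings\<close>

text \<open>A zero sum of one term gives the entry 0, its own negative; of two terms, an entry and
  its negative. Both are excluded, so the length bound in \<open>is_cycle\<close> is met.\<close>

lemma length_zero_sum_ge_3:
  fixes w :: "'g::ab_group_add list"
  assumes "\<forall>g\<in>set w. - g \<notin> set w" "sum_list w = 0" "w \<noteq> []"
  shows "3 \<le> length w"
proof (rule ccontr)
  assume "\<not> 3 \<le> length w"
  then consider a where "w = [a]" | a b where "w = [a, b]"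
    using assms(3) by (auto simp: neq_Nil_conv not_le numeral_3_eq_3 less_Suc_eq length_Suc_conv)
  then show False
  proof cases
    case 1
    then show ?thesis using assms by simp
  next
    case (2 a b)
    then have "b = - a" using assms(2) by (simp add: eq_neg_iff_add_eq_0 add.commute)
    then show ?thesis using assms(1) 2 by simp
  qed
qed

text \<open>The common argument for rows and columns: the lists partition \<open>E\<close>, so a
  difference \<open>a\<close> fixes a list and a position in it, and the tail of an edge then fixes
  the translate containing it.\<close>

lemma partial_sum_cycles_decomposition:
  fixes w :: "nat \<Rightarrow> 'g::ab_group_add list"
  assumes E: "E = (\<Union>i\<in>{1..k}. set (w i))" "\<forall>g\<in>E. - g \<notin> E"
    and zero: "\<And>i. i \<in> {1..k} \<Longrightarrow> sum_list (w i) = 0"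
    and simple: "\<And>i. i \<in> {1..k} \<Longrightarrow> simple_ordering (w i)"
    and dist: "\<And>i. i \<in> {1..k} \<Longrightarrow> distinct (w i)"
    and disj: "disjoint_family_on (\<lambda>i. set (w i)) {1..k}"
  defines "D \<equiv> {translate g B | B g. B \<in> partial_sum_cycles k w}"
  shows "regular_cycle_decomposition (Cay (pm E)) D" and "base_cycles (partial_sum_cycles k w) D"
proof -
  note edges_eq = edges_translate_partial_sum_cycle[OF zero]
  have cycles: "is_cycle B" if B: "B \<in> partial_sum_cycles k w" for B
  proof -
    obtain i where i: "i \<in> {1..k}" "w i \<noteq> []" "B = cycle_of (partial_sums (w i))"
      using B by (auto simp: partial_sum_cycles_def)
    have "3 \<le> length (w i)"
      using length_zero_sum_ge_3[OF _ zero[OF i(1)] i(2)] E i(1) by blast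
    then show ?thesis
      using i simple[OF i(1)] unfolding is_cycle_def simple_ordering_def
      by (metis length_partial_sums)
  qed
  then show "base_cycles (partial_sum_cycles k w) D"
    by (simp add: base_cycles_def D_def)
  have D_cases: "\<exists>i g. i \<in> {1..k} \<and> C = translate g (cycle_of (partial_sums (w i)))"
    if "C \<in> D" for C
    using that unfolding D_def partial_sum_cycles_def by blast
  \<comment> \<open>Normal form of an edge: the list \<open>i\<close>, the shift \<open>g\<close>
    and the position \<open>p\<close> it comes from.\<close>
  have D_edge: "\<exists>i g p. i \<in> {1..k} \<and> p < length (w i) \<and>
      C = translate g (cycle_of (partial_sums (w i))) \<and>
      e = {sum_list (take p (w i)) + g, sum_list (take p (w i)) + g + w i ! p}"
    if C: "C \<in> D" and e: "e \<in> edges C" for C e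
  proof -
    obtain i g where i: "i \<in> {1..k}" "C = translate g (cycle_of (partial_sums (w i)))"
      using D_cases[OF C] by blast
    have "e \<in> edges (translate g (cycle_of (partial_sums (w i))))"
      using e i(2) by simp
    then obtain p where "p < length (w i)"
        "e = {sum_list (take p (w i)) + g, sum_list (take p (w i)) + g + w i ! p}"
      unfolding edges_eq[OF i(1)] by blast
    then show ?thesis using i by blast
  qed
  have in_E: "w i ! p \<in> E" if "i \<in> {1..k}" "p < length (w i)" for i p
    using nth_mem[OF that(2)] that(1) unfolding E(1) by blast
  have sub: "edges C \<subseteq> edges (Cay (pm E))" if C: "C \<in> D" for C
  proof
    fix e assume "e \<in> edges C"
    then obtain i g p where "i \<in> {1..k}" "p < length (w i)"
        "e = {sum_list (take p (w i)) + g, sum_list (take p (w i)) + g + w i ! p}"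
      using D_edge[OF C] by blast
    then show "e \<in> edges (Cay (pm E))"
      using in_E unfolding edges_Cay_pm by blast
  qed
  have "disjoint_family_on edges D"
    unfolding disjoint_family_on_def
  proof (intro ballI impI)
    fix C C' assume C: "C \<in> D" "C' \<in> D" "C \<noteq> C'"
    show "edges C \<inter> edges C' = {}"
    proof (rule ccontr)
      assume "edges C \<inter> edges C' \<noteq> {}"
      then obtain e where e: "e \<in> edges C" "e \<in> edges C'" by blast
      obtain i g p where 1: "i \<in> {1..k}" "p < length (w i)"
        "C = translate g (cycle_of (partial_sums (w i)))"
        "e = {sum_list (take p (w i)) + g, sum_list (take p (w i)) + g + w i ! p}"
        using D_edge[OF C(1) e(1)] by blast
      obtain i' g' p' where 2: "i' \<in> {1..k}" "p' < length (w i')"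
        "C' = translate g' (cycle_of (partial_sums (w i')))"
        "e = {sum_list (take p' (w i')) + g', sum_list (take p' (w i')) + g' + w i' ! p'}"
        using D_edge[OF C(2) e(2)] by blast
      \<comment> \<open>Both normal forms describe the same edge, so tails and differences
        agree.\<close>
      have u: "sum_list (take p (w i)) + g = sum_list (take p' (w i')) + g'"
        "w i ! p = w i' ! p'"
        using edge_difference_unique[OF E(2) in_E[OF 1(1,2)] in_E[OF 2(1,2)] 1(4)[symmetric, unfolded 2(4)]]
        by simp_all
      \<comment> \<open>The shared difference forces the same list by disjointness and then the same
        position by distinctness. The prefix sums now agree, so equal tails give equal
        shifts.\<close>
      have "w i ! p \<in> set (w i) \<inter> set (w i')"
        using u(2) nth_mem[OF 1(2)] nth_mem[OF 2(2)] by simp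
      then have "i = i'" using disj 1(1) 2(1) unfolding disjoint_family_on_def by blast
      moreover from this have "p = p'"
        using u(2) 1(2) 2(2) dist[OF 1(1)] by (simp add: nth_eq_iff_index_eq)
      ultimately have "C = C'" using u(1) 1(3) 2(3) by simp
      then show False using C(3) by simp
    qed
  qed
  moreover have "(\<Union>C\<in>D. edges C) = edges (Cay (pm E))"
  proof
    show "(\<Union>C\<in>D. edges C) \<subseteq> edges (Cay (pm E))" using sub by blast
    show "edges (Cay (pm E)) \<subseteq> (\<Union>C\<in>D. edges C)"
    proof
      fix e assume "e \<in> edges (Cay (pm E))"
      then obtain x a where e: "e = {x, x + a}" "a \<in> E" unfolding edges_Cay_pm by blast
      then obtain i where i: "i \<in> {1..k}" "a \<in> set (w i)" unfolding E(1) by blast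
      then obtain p where p: "p < length (w i)" "w i ! p = a" by (auto simp: in_set_conv_nth)
      \<comment> \<open>The shift that carries the prefix sum before the occurrence of
        \<open>a\<close> to the prescribed tail \<open>x\<close>.\<close>
      define g where "g = x - sum_list (take p (w i))"
      have "e = {sum_list (take p (w i)) + g, sum_list (take p (w i)) + g + w i ! p}"
        using e(1) p(2) by (simp add: g_def)
      then have "e \<in> edges (translate g (cycle_of (partial_sums (w i))))"
        using p(1) unfolding edges_eq[OF i(1)] by blast
      \<comment> \<open>\<open>partial_sum_cycles\<close> admits only nonempty lists; here
        \<open>a\<close> witnesses nonemptiness.\<close>
      moreover have "w i \<noteq> []" using i(2) by auto
      then have "translate g (cycle_of (partial_sums (w i))) \<in> D"
        using i(1) unfolding D_def partial_sum_cycles_def by blast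
      ultimately show "e \<in> (\<Union>C\<in>D. edges C)" by blast
    qed
  qed
  moreover have "\<forall>C\<in>D. is_cycle C \<and> subgraph C (Cay (pm E))"
  proof
    fix C assume C: "C \<in> D"
    then have "is_cycle C"
      using cycles is_cycle_translate unfolding D_def by blast
    moreover have "verts C \<subseteq> verts (Cay (pm E))" by (simp add: Cay_def)
    ultimately show "is_cycle C \<and> subgraph C (Cay (pm E))"
      using sub[OF C] by (simp add: subgraph_def)
  qed
  ultimately show "regular_cycle_decomposition (Cay (pm E)) D"
    using translate_image_translates[of _ "partial_sum_cycles k w", folded D_def]
    by (simp add: regular_cycle_decomposition_def cycle_decomposition_def)
qed

section \<open>Orthogonality\<close>

text \<open>The difference of a shared edge is an entry of both lists, so all shared edges have the
  same difference. It occurs at only one position of \<open>u\<close>, and a fixed translate has one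
  edge per position.\<close>

lemma translate_orthogonal:
  fixes u v :: "'g::ab_group_add list"
  assumes E: "set u \<subseteq> E" "set v \<subseteq> E" "\<forall>g\<in>E. - g \<notin> E"
    and zero: "sum_list u = 0" "sum_list v = 0"
    and u: "distinct u"
    and common: "\<And>a b. a \<in> set u \<inter> set v \<Longrightarrow> b \<in> set u \<inter> set v \<Longrightarrow> a = b"
    and e: "e \<in> edges (translate g (cycle_of (partial_sums u)))"
      "e \<in> edges (translate h (cycle_of (partial_sums v)))"
    and f: "f \<in> edges (translate g (cycle_of (partial_sums u)))"
      "f \<in> edges (translate h (cycle_of (partial_sums v)))"
  shows "e = f"
proof -
  have shared: "\<exists>p<length u. u ! p \<in> set u \<inter> set v \<and>
      d = {sum_list (take p u) + g, sum_list (take p u) + g + u ! p}"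
    if d: "d \<in> edges (translate g (cycle_of (partial_sums u)))"
      "d \<in> edges (translate h (cycle_of (partial_sums v)))" for d
  proof -
    obtain p where p: "p < length u"
      "d = {sum_list (take p u) + g, sum_list (take p u) + g + u ! p}"
      using d(1) unfolding edges_translate_partial_sum_cycle[OF zero(1)] by blast
    obtain q where q: "q < length v"
      "d = {sum_list (take q v) + h, sum_list (take q v) + h + v ! q}"
      using d(2) unfolding edges_translate_partial_sum_cycle[OF zero(2)] by blast
    have "u ! p \<in> E" "v ! q \<in> E" using E(1,2) nth_mem[OF p(1)] nth_mem[OF q(1)] by blast+
    from edge_difference_unique[OF E(3) this p(2)[symmetric, unfolded q(2)]]
    have "u ! p = v ! q" by (simp only: )
    then have "u ! p \<in> set u \<inter> set v"
      using nth_mem[OF p(1)] nth_mem[OF q(1)] by simp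
    then show ?thesis using p by blast
  qed
  obtain p where p: "p < length u" "u ! p \<in> set u \<inter> set v"
    "e = {sum_list (take p u) + g, sum_list (take p u) + g + u ! p}"
    using shared[OF e] by blast
  obtain q where q: "q < length u" "u ! q \<in> set u \<inter> set v"
    "f = {sum_list (take q u) + g, sum_list (take q u) + g + u ! q}"
    using shared[OF f] by blast
  have "p = q"
    using common[OF p(2) q(2)] u p(1) q(1) by (simp add: nth_eq_iff_index_eq)
  then show ?thesis using p(3) q(3) by simp
qed

section \<open>Application to the rows and columns of an Archdeacon array\<close>

theorem proposition5p3:
  fixes A :: "nat \<Rightarrow> nat \<Rightarrow> 'g::ab_group_add option"
    and m n :: nat
    and \<omega>r \<omega>c :: "nat \<Rightarrow> 'g list"
  assumes "archdeacon_array m n A"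
    and "\<And>i. i \<in> {1..m} \<Longrightarrow> ordering_of (\<omega>r i) (row_entries n A i) \<and> simple_ordering (\<omega>r i)"
    and "\<And>j. j \<in> {1..n} \<Longrightarrow> ordering_of (\<omega>c j) (col_entries m A j) \<and> simple_ordering (\<omega>c j)"
  shows "\<exists>Dr Dc.
      regular_cycle_decomposition (Cay (pm (set (entries m n A)))) Dr \<and>
      base_cycles (partial_sum_cycles m \<omega>r) Dr \<and>
      regular_cycle_decomposition (Cay (pm (set (entries m n A)))) Dc \<and>
      base_cycles (partial_sum_cycles n \<omega>c) Dc \<and>
      orthogonal_decompositions Dr Dc"
proof -
  define E where "E = set (entries m n A)"
  have arch: "distinct (entries m n A)" "\<forall>g\<in>E. - g \<notin> E"
    "\<forall>i\<in>{1..m}. sum_list (row_entries n A i) = 0"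
    "\<forall>j\<in>{1..n}. sum_list (col_entries m A j) = 0"
    using assms(1) by (auto simp: archdeacon_array_def E_def)
  note cell = distinct_entries_cell_unique[OF arch(1)]
  have mr: "mset (\<omega>r i) = mset (row_entries n A i)" "simple_ordering (\<omega>r i)" if "i \<in> {1..m}" for i
    using assms(2)[OF that] by (auto simp: ordering_of_def)
  have mc: "mset (\<omega>c j) = mset (col_entries m A j)" "simple_ordering (\<omega>c j)" if "j \<in> {1..n}" for j
    using assms(3)[OF that] by (auto simp: ordering_of_def)
  have setr: "set (\<omega>r i) = {a. \<exists>j\<in>{1..n}. A i j = Some a}" if "i \<in> {1..m}" for i
    using mset_eq_setD[OF mr(1)[OF that]] by (simp add: set_row_entries)
  have setc: "set (\<omega>c j) = {a. \<exists>i\<in>{1..m}. A i j = Some a}" if "j \<in> {1..n}" for j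
    using mset_eq_setD[OF mc(1)[OF that]] by (simp add: set_col_entries)
  have zr: "sum_list (\<omega>r i) = 0" if "i \<in> {1..m}" for i
    using arch(3) mr(1)[OF that] that by (metis sum_mset_sum_list)
  have zc: "sum_list (\<omega>c j) = 0" if "j \<in> {1..n}" for j
    using arch(4) mc(1)[OF that] that by (metis sum_mset_sum_list)
  have dr: "distinct (\<omega>r i)" if "i \<in> {1..m}" for i
    using distinct_row_entries[OF arch(1) that] mset_eq_imp_distinct_iff[OF mr(1)[OF that]] by simp
  have dc: "distinct (\<omega>c j)" if "j \<in> {1..n}" for j
    using distinct_col_entries[OF arch(1) that] mset_eq_imp_distinct_iff[OF mc(1)[OF that]] by simp
  have Er: "E = (\<Union>i\<in>{1..m}. set (\<omega>r i))"
    unfolding E_def set_entries_rows using mset_eq_setD[OF mr(1)] by simp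
  have Ec: "E = (\<Union>j\<in>{1..n}. set (\<omega>c j))"
    unfolding E_def set_entries_cols using mset_eq_setD[OF mc(1)] by simp
  have disjr: "disjoint_family_on (\<lambda>i. set (\<omega>r i)) {1..m}"
    unfolding disjoint_family_on_def using setr cell by blast
  have disjc: "disjoint_family_on (\<lambda>j. set (\<omega>c j)) {1..n}"
    unfolding disjoint_family_on_def using setc cell by blast
  \<comment> \<open>The families that \<open>base_cycles\<close> prescribes.\<close>
  define Dr where "Dr = {translate g B | B g. B \<in> partial_sum_cycles m \<omega>r}"
  define Dc where "Dc = {translate g B | B g. B \<in> partial_sum_cycles n \<omega>c}"
  have "orthogonal_decompositions Dr Dc"
    unfolding orthogonal_decompositions_def
  proof (intro ballI)
    fix B B' e f
    assume B: "B \<in> Dr" "B' \<in> Dc" and ef: "e \<in> edges B \<inter> edges B'" "f \<in> edges B \<inter> edges B'"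
    obtain i g where i: "i \<in> {1..m}" "B = translate g (cycle_of (partial_sums (\<omega>r i)))"
      using B(1) by (auto simp: Dr_def partial_sum_cycles_def)
    obtain j h where j: "j \<in> {1..n}" "B' = translate h (cycle_of (partial_sums (\<omega>c j)))"
      using B(2) by (auto simp: Dc_def partial_sum_cycles_def)
    \<comment> \<open>Such an \<open>a\<close> fills some cell of row \<open>i\<close> and some cell
      of column \<open>j\<close>; by uniqueness of cells these coincide, so the cell is
      \<open>(i, j)\<close>. Since it holds at most one value, the two lists share at most one
      entry.\<close>
    have common: "A i j = Some a" if "a \<in> set (\<omega>r i) \<inter> set (\<omega>c j)" for a
      using that cell i(1) j(1) unfolding setr[OF i(1)] setc[OF j(1)] by blast
    have sub: "set (\<omega>r i) \<subseteq> E" "set (\<omega>c j) \<subseteq> E"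
      using Er Ec i(1) j(1) by blast+
    show "e = f"
    proof (rule translate_orthogonal[OF sub arch(2) zr[OF i(1)] zc[OF j(1)] dr[OF i(1)]])
      show "a = b" if "a \<in> set (\<omega>r i) \<inter> set (\<omega>c j)" "b \<in> set (\<omega>r i) \<inter> set (\<omega>c j)" for a b
        using common[OF that(1)] common[OF that(2)] by simp
    qed (use ef i j in auto)
  qed
  moreover note partial_sum_cycles_decomposition[OF Er arch(2) zr mr(2) dr disjr, folded Dr_def]
    and partial_sum_cycles_decomposition[OF Ec arch(2) zc mc(2) dc disjc, folded Dc_def]
  ultimately show ?thesis
    unfolding E_def by blast
qed

end
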